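(* Let $n\in\mathbb{N}$, $a\in\mathbb{R}$, and let $f$ be an arbitrary differentiable function (for which the fractional derivatives below exist). Then \[ (\partial_x)^{a}\,[(x)_n f(x)] = \sum_{m=0}^{n}\sum_{u=0}^{m}\binom{n}{m}\,S_1(m,u)\,(x)_{n-m}\,(a)_{u}\,(\partial_x)^{a-u}[f(x)]. \]
   Context: $(x)_n = x(x-1)\cdots(x-n+1)$ is the falling factorial, $(x)_0=1$, and $\binom{a}{m}=(a)_m/m!$. $S_1(n,m)$ are the (signed) Stirling numbers of the first kind, defined by $(x)_n=\sum_{m=0}^n S_1(n,m)x^m$. For $a\in\mathbb{R}$, $(\partial_x)^a$ denotes fractional differentiation of order $a$ with respect to $x$: a family of linear operators which agree with the ordinary derivative of order $a$ when $a$ is a nonnegative integer and which obey the extension of the general Leibniz rule to real order: for a polynomial $p$ and a function $f$ for which the terms exist, \[ (\partial_x)^a[p(x)f(x)] = \sum_{m=0}^{\infty}\binom{a}{m}\,(\partial_x)^{a-m}[f(x)]\;p^{(m)}(x). \] *)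

theory Defs
  imports "HOL-Analysis.Analysis" "HOL-Computational_Algebra.Polynomial"
begin

definition falling_fact :: "'a::comm_ring_1 \<Rightarrow> nat \<Rightarrow> 'a" where
  "falling_fact x n = (\<Prod>i<n. x - of_nat i)"

text \<open>Signed Stirling numbers of the first kind: the coefficients of the falling factorial of the
  indeterminate.\<close>

definition S1 :: "nat \<Rightarrow> nat \<Rightarrow> int" where
  "S1 n m = coeff (falling_fact [:0, 1:] n) m"

lemma falling_fact_0 [simp]: "falling_fact x 0 = 1"
  by (simp add: falling_fact_def)

lemma falling_fact_Suc: "falling_fact x (Suc n) = falling_fact x n * (x - of_nat n)"
  by (simp add: falling_fact_def)

lemma falling_fact_X_Suc:
  "falling_fact [:0, 1:] (Suc n) =
     pCons 0 (falling_fact [:0, 1:] n) - smult (of_nat n) (falling_fact [:0, 1:] n)"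
  for n :: nat
  by (simp add: falling_fact_Suc right_diff_distrib mult.commute of_nat_poly)

lemma S1_0_0: "S1 0 0 = 1"
  by (simp add: S1_def)

lemma S1_Suc_0: "S1 (Suc n) 0 = - int n * S1 n 0"
  by (simp add: S1_def falling_fact_X_Suc)

lemma S1_Suc_Suc: "S1 (Suc n) (Suc m) = S1 n m - int n * S1 n (Suc m)"
  by (simp add: S1_def falling_fact_X_Suc)

lemma S1_eq_0: "n < m \<Longrightarrow> S1 n m = 0"
proof (induction n arbitrary: m)
  case 0
  then show ?case by (cases m) (simp_all add: S1_def)
next
  case (Suc n)
  then show ?case by (cases m) (simp_all add: S1_Suc_Suc)
qed

theorem falling_fact_eq_sum_S1:
  "falling_fact x n = (\<Sum>m=0..n. of_int (S1 n m) * x ^ m)"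
proof (induction n)
  case 0
  then show ?case by (simp add: S1_0_0)
next
  case (Suc n)
  have shift: "(\<Sum>m=0..n. of_int (S1 n (Suc m)) * x ^ Suc m) + of_int (S1 n 0)
      = (\<Sum>m=0..n. of_int (S1 n m) * x ^ m)"
    using sum.atLeast0_atMost_Suc_shift[of "\<lambda>m. of_int (S1 n m) * x ^ m" n]
    by (simp add: S1_eq_0 add.commute)
  have "(\<Sum>m=0..Suc n. of_int (S1 (Suc n) m) * x ^ m)
      = of_int (S1 (Suc n) 0) + (\<Sum>m=0..n. of_int (S1 (Suc n) (Suc m)) * x ^ Suc m)"
    by (subst sum.atLeast0_atMost_Suc_shift) simp
  also have "\<dots> = x * (\<Sum>m=0..n. of_int (S1 n m) * x ^ m)
      - of_nat n * ((\<Sum>m=0..n. of_int (S1 n (Suc m)) * x ^ Suc m) + of_int (S1 n 0))"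
    by (simp add: S1_Suc_0 S1_Suc_Suc algebra_simps sum_subtractf sum_distrib_left sum.distrib)
  also have "\<dots> = falling_fact x (Suc n)"
    by (simp only: shift Suc falling_fact_Suc) (simp add: Suc algebra_simps)
  finally show ?case by simp
qed

text \<open>\<open>f\<close> has ordinary derivatives up to order \<open>k\<close> at every point of the open set \<open>X\<close>; they are
  \<open>(deriv ^^ j) f\<close> for \<open>j \<le> k\<close>.\<close>

definition times_differentiable_on :: "nat \<Rightarrow> (real \<Rightarrow> real) \<Rightarrow> real set \<Rightarrow> bool" where
  "times_differentiable_on k f X \<longleftrightarrow>
     (\<forall>j<k. \<forall>x\<in>X. (deriv ^^ j) f differentiable (at x))"

text \<open>A family \<open>D a\<close> (\<open>a\<close> real) of linear operators on functions \<open>X \<rightarrow> \<real>\<close>, represented by total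
  functions that matter only on \<open>X\<close>. The operators are partial: \<open>Dom a\<close> is the set of functions whose
  derivative of order \<open>a\<close> exists, and \<open>D a f\<close> has no meaning for \<open>f \<notin> Dom a\<close>.

  In the Leibniz rule, ``the terms exist'' means that the left-hand side exists and so does the
  derivative of \<open>f\<close> in every term whose coefficient is not identically zero; terms with zero
  coefficient, in particular all those beyond the degree of \<open>p\<close>, count as zero.\<close>

locale fractional_differentiation =
  fixes X :: "real set"
    and Dom :: "real \<Rightarrow> (real \<Rightarrow> real) set"
    and D :: "real \<Rightarrow> (real \<Rightarrow> real) \<Rightarrow> real \<Rightarrow> real"
  assumes open_X: "open X"
    and Dom_cong: "\<lbrakk>f \<in> Dom a; \<And>x. x \<in> X \<Longrightarrow> f x = g x\<rbrakk> \<Longrightarrow> g \<in> Dom a"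
    and D_cong: "\<lbrakk>f \<in> Dom a; \<And>x. x \<in> X \<Longrightarrow> f x = g x; x \<in> X\<rbrakk> \<Longrightarrow> D a f x = D a g x"
    and Dom_zero: "(\<lambda>x. 0) \<in> Dom a"
    and Dom_linear: "\<lbrakk>f \<in> Dom a; g \<in> Dom a\<rbrakk> \<Longrightarrow> (\<lambda>x. b * f x + c * g x) \<in> Dom a"
    and D_linear: "\<lbrakk>f \<in> Dom a; g \<in> Dom a; x \<in> X\<rbrakk> \<Longrightarrow>
          D a (\<lambda>x. b * f x + c * g x) x = b * D a f x + c * D a g x"
    and Dom_nat: "times_differentiable_on k f X \<Longrightarrow> f \<in> Dom (real k)"
    and D_nat: "\<lbrakk>times_differentiable_on k f X; x \<in> X\<rbrakk> \<Longrightarrow> D (real k) f x = (deriv ^^ k) f x"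
    and Leibniz: "\<lbrakk>(\<lambda>x. poly p x * f x) \<in> Dom a;
          \<And>m. \<lbrakk>a gchoose m \<noteq> 0; (pderiv ^^ m) p \<noteq> 0\<rbrakk> \<Longrightarrow> f \<in> Dom (a - real m);
          x \<in> X\<rbrakk> \<Longrightarrow>
          (\<lambda>m. (a gchoose m) * D (a - real m) f x * poly ((pderiv ^^ m) p) x)
            sums D a (\<lambda>x. poly p x * f x) x"

end

theory Submission
  imports Defs
begin

text \<open>By the Leibniz rule the coefficient of the derivative of \<open>f\<close> of order \<open>a - u\<close> is
  \<open>(a)\<^sub>u\<close> times the coefficient of \<open>y ^ u\<close> in the Taylor expansion of \<open>(x + y)\<^sub>n\<close> at \<open>x\<close>. That
  coefficient is read off from Vandermonde's identity
  \<open>(x + y)\<^sub>n = (\<Sum>m\<le>n. (n choose m) (x)\<^sub>n\<^sub>-\<^sub>m (y)\<^sub>m)\<close> by expanding each \<open>(y)\<^sub>m\<close> in powers of \<open>y\<close>.\<close>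

text \<open>By induction: the new factor \<open>x + y - n\<close> splits as
  \<open>(x - (n - m)) + (y - m)\<close>, each half lengthening one of the two falling factorials,
  and Pascal's rule merges the two resulting sums.\<close>

lemma falling_fact_add:
  fixes x y :: "'a::comm_ring_1"
  shows "falling_fact (x + y) n
    = (\<Sum>m\<le>n. of_nat (n choose m) * falling_fact x (n - m) * falling_fact y m)"
proof (induction n)
  case 0
  then show ?case by simp
next
  case (Suc n)
  let ?t = "\<lambda>m. of_nat (n choose m) * falling_fact x (n - m) * falling_fact y m"
  let ?A = "\<lambda>m. of_nat (n choose m) * falling_fact x (Suc n - m) * falling_fact y m"
  let ?B = "\<lambda>m. of_nat (n choose m) * falling_fact x (n - m) * falling_fact y (Suc m)"
  have split: "?t m * (x + y - of_nat n) = ?A m + ?B m" if "m \<le> n" for m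
  proof -
    have "x + y - of_nat n = (x - of_nat (n - m)) + (y - of_nat m)"
      using that by (simp add: of_nat_diff)
    then have "?t m * (x + y - of_nat n) = ?t m * ((x - of_nat (n - m)) + (y - of_nat m))"
      by (rule arg_cong)
    then show ?thesis
      using that by (simp add: Suc_diff_le falling_fact_Suc algebra_simps)
  qed
  have "falling_fact (x + y) (Suc n) = (\<Sum>m\<le>n. ?t m * (x + y - of_nat n))"
    by (simp add: falling_fact_Suc Suc sum_distrib_right)
  also have "\<dots> = (\<Sum>m\<le>n. ?A m) + (\<Sum>m\<le>n. ?B m)"
    by (simp add: split sum.distrib)
  \<comment> \<open>The added term is zero because \<open>n choose Suc n = 0\<close>. After the
    index shift, \<open>?A (Suc m)\<close> and \<open>?B m\<close> differ only in their binomial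
    coefficients.\<close>
  also have "(\<Sum>m\<le>n. ?A m) = (\<Sum>m\<le>Suc n. ?A m)"
    by (simp add: binomial_eq_0)
  also have "\<dots> = falling_fact x (Suc n) + (\<Sum>m\<le>n. ?A (Suc m))"
    by (subst sum.atMost_Suc_shift) simp
  also have "falling_fact x (Suc n) + (\<Sum>m\<le>n. ?A (Suc m)) + (\<Sum>m\<le>n. ?B m)
    = (\<Sum>m\<le>Suc n. of_nat (Suc n choose m) * falling_fact x (Suc n - m) * falling_fact y m)"
    by (subst sum.atMost_Suc_shift) (simp add: sum.distrib algebra_simps)
  finally show ?case .
qed

text \<open>\<open>S1\<close> comes from integer polynomials; expanding the falling factorial of the
  indeterminate over any commutative ring gives the same coefficients.\<close>

lemma coeff_falling_fact_X:
  "coeff (falling_fact [:0, 1 :: 'a::comm_ring_1:] n) m = of_int (S1 n m)"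
proof -
  have "falling_fact [:0, 1 :: 'a:] n = (\<Sum>k=0..n. monom (of_int (S1 n k)) k)"
    by (simp add: falling_fact_eq_sum_S1 monom_altdef of_int_poly)
  then show ?thesis
    by (simp add: coeff_sum S1_eq_0)
qed

lemma pcompose_falling_fact:
  "falling_fact p n \<circ>\<^sub>p q = falling_fact (p \<circ>\<^sub>p q) n" for p q :: "'a::idom poly"
  by (simp add: falling_fact_def pcompose_prod pcompose_diff of_nat_poly)

lemma poly_falling_fact: "poly (falling_fact p n) x = falling_fact (poly p x) n"
  by (simp add: falling_fact_def poly_prod)

text \<open>Chain rule: the inner polynomial \<open>[:x, 1:]\<close> has derivative 1.\<close>

lemma higher_pderiv_pcompose_offset:
  "(pderiv ^^ k) p \<circ>\<^sub>p [:x, 1:] = (pderiv ^^ k) (p \<circ>\<^sub>p [:x, 1:])"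
  for p :: "'a::idom poly"
proof (induction k)
  case (Suc k)
  then show ?case
    by (simp flip: Suc.IH add: pderiv_pcompose pderiv_pCons)
qed simp

text \<open>Taylor's formula: after the shift by \<open>x\<close>, the derivative is evaluated at 0,
  where only the constant coefficient survives.\<close>

lemma poly_higher_pderiv:
  "poly ((pderiv ^^ k) p) x = fact k * coeff (p \<circ>\<^sub>p [:x, 1:]) k" for p :: "real poly"
proof -
  have "poly ((pderiv ^^ k) p) x = coeff ((pderiv ^^ k) p \<circ>\<^sub>p [:x, 1:]) 0"
    by (simp add: poly_0_coeff_0[symmetric] poly_pcompose)
  then show ?thesis
    by (simp add: higher_pderiv_pcompose_offset coeff_higher_pderiv pochhammer_fact)
qed

text \<open>Vandermonde's identity is applied in the polynomial ring, to the constant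
  \<open>[:x:]\<close> and the indeterminate.\<close>

lemma poly_higher_pderiv_falling_fact:
  "poly ((pderiv ^^ u) (falling_fact [:0, 1:] n)) x
    = fact u * (\<Sum>m\<le>n. real (n choose m) * of_int (S1 m u) * falling_fact x (n - m))"
proof -
  have const: "falling_fact [:x:] k = [:falling_fact x k:]" for k
    by (induction k) (simp_all add: falling_fact_Suc of_nat_poly one_pCons mult.commute)
  have "falling_fact [:0, 1:] n \<circ>\<^sub>p [:x, 1:] = falling_fact ([:x:] + [:0, 1:]) n"
    by (simp add: pcompose_falling_fact pcompose_pCons)
  also have "\<dots> = (\<Sum>m\<le>n. smult (real (n choose m) * falling_fact x (n - m))
                          (falling_fact [:0, 1:] m))"
    unfolding falling_fact_add by (simp add: const of_nat_poly mult.commute)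
  finally show ?thesis
    by (simp add: poly_higher_pderiv coeff_sum coeff_falling_fact_X mult_ac)
qed

lemma falling_fact_eq_fact_gchoose: "falling_fact a k = fact k * (a gchoose k)"
  for a :: "'a::field_char_0"
  by (simp add: falling_fact_def gbinomial_prod_rev atLeast0LessThan)

lemma higher_pderiv_falling_fact_eq_0:
  assumes "n < u"
  shows "(pderiv ^^ u) (falling_fact [:0, 1:] n :: real poly) = 0"
  using assms by (intro poly_eqI) (simp add: coeff_higher_pderiv coeff_falling_fact_X S1_eq_0)

theorem theorem4p3:
  fixes n :: nat and a :: real and f :: "real \<Rightarrow> real"
    and X :: "real set"
    and Dom :: "real \<Rightarrow> (real \<Rightarrow> real) set"
    and D :: "real \<Rightarrow> (real \<Rightarrow> real) \<Rightarrow> real \<Rightarrow> real"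
  assumes "fractional_differentiation X Dom D"
    and "\<forall>x\<in>X. f differentiable (at x)"
    and "(\<lambda>x. falling_fact x n * f x) \<in> Dom a"
    and "\<forall>u\<le>n. falling_fact a u \<noteq> 0 \<longrightarrow> f \<in> Dom (a - real u)"
  shows "\<forall>x\<in>X. D a (\<lambda>x. falling_fact x n * f x) x =
    (\<Sum>m=0..n. \<Sum>u=0..m. real (n choose m) * of_int (S1 m u) * falling_fact x (n - m)
        * falling_fact a u * D (a - real u) f x)"
proof
  fix x assume "x \<in> X"
  interpret fractional_differentiation X Dom D by fact
  define p :: "real poly" where "p = falling_fact [:0, 1:] n"
  have poly_p: "poly p y = falling_fact y n" for y
    by (simp add: p_def poly_falling_fact)
  have vanish: "(pderiv ^^ u) p = 0" if "n < u" for u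
    unfolding p_def using that by (rule higher_pderiv_falling_fact_eq_0)
  let ?L = "\<lambda>u. (a gchoose u) * D (a - real u) f x * poly ((pderiv ^^ u) p) x"
  have "?L sums D a (\<lambda>x. poly p x * f x) x"
  proof (rule Leibniz)
    \<comment> \<open>The second condition forces \<open>m \<le> n\<close>; the first then says
      \<open>falling_fact a m \<noteq> 0\<close>, as these differ by the factor
      \<open>fact m\<close>.\<close>
    fix m assume "a gchoose m \<noteq> 0" "(pderiv ^^ m) p \<noteq> 0"
    then show "f \<in> Dom (a - real m)"
      using assms(4) vanish[of m] by (cases "m \<le> n") (simp_all add: falling_fact_eq_fact_gchoose)
  qed (use assms(3) \<open>x \<in> X\<close> in \<open>simp_all add: poly_p\<close>)
  moreover have "?L sums (\<Sum>u\<le>n. ?L u)"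
    by (rule sums_finite) (simp_all add: vanish)
  ultimately have "D a (\<lambda>x. falling_fact x n * f x) x = (\<Sum>u\<le>n. ?L u)"
    by (simp add: poly_p sums_unique2)
  \<comment> \<open>The \<open>fact u\<close> of the Taylor coefficient turns
    \<open>a gchoose u\<close> into \<open>falling_fact a u\<close>.\<close>
  also have "\<dots> = (\<Sum>u\<le>n. \<Sum>m\<le>n. real (n choose m) * of_int (S1 m u) * falling_fact x (n - m)
        * falling_fact a u * D (a - real u) f x)"
    by (simp add: p_def poly_higher_pderiv_falling_fact falling_fact_eq_fact_gchoose
        sum_distrib_left mult_ac)
  also have "\<dots> = (\<Sum>m\<le>n. \<Sum>u\<le>n. real (n choose m) * of_int (S1 m u) * falling_fact x (n - m)
        * falling_fact a u * D (a - real u) f x)"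
    by (rule sum.swap)
  \<comment> \<open>The square of indices shrinks to a triangle, since \<open>S1 m u = 0\<close> for
    \<open>u > m\<close>.\<close>
  also have "\<dots> = (\<Sum>m=0..n. \<Sum>u=0..m. real (n choose m) * of_int (S1 m u)
        * falling_fact x (n - m) * falling_fact a u * D (a - real u) f x)"
    unfolding atLeast0AtMost
    by (intro sum.cong refl sum.mono_neutral_right) (auto simp: S1_eq_0)
  finally show "D a (\<lambda>x. falling_fact x n * f x) x = (\<Sum>m=0..n. \<Sum>u=0..m. real (n choose m)
        * of_int (S1 m u) * falling_fact x (n - m) * falling_fact a u * D (a - real u) f x)" .
qed

end
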